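(* Let $\lambda_n$ be the number of closed lambda-terms of size $n$. There are positive constants $c_1,c_2$ such that for every $\varepsilon>0$ and all sufficiently large $n$, $$c_1\left(\frac{4n}{e\log n}\right)^{n/2}\frac{\sqrt{\log n}}{n}\le\lambda_n\le c_2\left(\frac{9(1+\varepsilon)n}{e\log n}\right)^{n/2}\frac{(\log n)^{n/(2\log n)}}{n^{3/2}}.$$
   Context: Lambda-terms are generated by the grammar $T::=x\mid (T*T)\mid \lambda x.T$; an abstraction $\lambda x.T$ binds the free occurrences of $x$ in $T$; a term is closed if no variable occurrence is free. Terms are counted up to renaming of bound variables (only the binding structure matters; e.g. $\lambda y.(\lambda x.x*\lambda z.y)$ and $\lambda x.(\lambda y.y*\lambda z.x)$ are identical). Size: $|x|=1$, $|\lambda x.T|=1+|T|$, $|(S*T)|=1+|S|+|T|$, i.e. the total number of variable occurrences, abstractions and applications. *)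

theory Defs
  imports Complex_Main
begin

datatype lterm = Var nat | App lterm lterm | Lam nat lterm

primrec tsize :: "lterm \<Rightarrow> nat" where
  "tsize (Var x) = 1"
| "tsize (App s t) = 1 + tsize s + tsize t"
| "tsize (Lam x t) = 1 + tsize t"

primrec fv :: "lterm \<Rightarrow> nat set" where
  "fv (Var x) = {x}"
| "fv (App s t) = fv s \<union> fv t"
| "fv (Lam x t) = fv t - {x}"

primrec vars :: "lterm \<Rightarrow> nat set" where
  "vars (Var x) = {x}"
| "vars (App s t) = vars s \<union> vars t"
| "vars (Lam x t) = insert x (vars t)"

text \<open>Replaces the free occurrences of \<open>x\<close> by \<open>y\<close>. This is not capture-avoiding, and is
  only used below when \<open>y\<close> does not occur in the term, not even as a binder.\<close>

primrec rename :: "nat \<Rightarrow> nat \<Rightarrow> lterm \<Rightarrow> lterm" where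
  "rename x y (Var z) = Var (if z = x then y else z)"
| "rename x y (App s t) = App (rename x y s) (rename x y t)"
| "rename x y (Lam z t) = Lam z (if z = x then t else rename x y t)"

text \<open>Equality up to renaming of bound variables: the least congruence that allows a binder
  to be renamed to a variable not occurring in its body.\<close>

inductive alpha :: "lterm \<Rightarrow> lterm \<Rightarrow> bool" where
  rename: "y \<notin> vars t \<Longrightarrow> alpha (Lam x t) (Lam y (rename x y t))"
| app: "alpha s s' \<Longrightarrow> alpha t t' \<Longrightarrow> alpha (App s t) (App s' t')"
| lam: "alpha t t' \<Longrightarrow> alpha (Lam x t) (Lam x t')"
| refl: "alpha t t"
| sym: "alpha s t \<Longrightarrow> alpha t s"
| trans: "alpha s t \<Longrightarrow> alpha t u \<Longrightarrow> alpha s u"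

definition alpha_rel :: "(lterm \<times> lterm) set" where
  "alpha_rel = {(s, t). alpha s t}"

lemma equiv_alpha_rel: "equiv UNIV alpha_rel"
  unfolding alpha_rel_def
  by (rule equivI) (auto simp: refl_on_def sym_def trans_def intro: alpha.refl alpha.sym alpha.trans)

lemma tsize_rename [simp]: "tsize (rename x y t) = tsize t"
  by (induction t) auto

lemma alpha_tsize: "alpha s t \<Longrightarrow> tsize s = tsize t"
  by (induction rule: alpha.induct) auto

lemma fv_subset_vars: "fv t \<subseteq> vars t"
  by (induction t) auto

lemma fv_rename:
  "y \<notin> vars t \<Longrightarrow> fv (rename x y t) = (if x \<in> fv t then insert y (fv t - {x}) else fv t)"
  by (induction t) auto

lemma alpha_fv: "alpha s t \<Longrightarrow> fv s = fv t"
proof (induction rule: alpha.induct)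
  case (rename y t x)
  then have "y \<notin> fv t" using fv_subset_vars by blast
  with rename show ?case by (auto simp: fv_rename)
qed auto

text \<open>By \<open>alpha_tsize\<close> and \<open>alpha_fv\<close>, closedness and size depend only on the
  class of a term, so the quotient below consists of classes all of whose
  members are closed of size \<open>n\<close>.\<close>

definition num_closed :: "nat \<Rightarrow> nat" where
  "num_closed n = card ({t. fv t = {} \<and> tsize t = n} // alpha_rel)"

end

theory Submission
  imports Defs "HOL-Computational_Algebra.Formal_Power_Series" "HOL-Real_Asymp.Real_Asymp"
begin

text \<open>
  Naming the binder at depth \<open>d\<close> by \<open>d\<close> gives one canonical representative in each
  \<open>\<alpha>\<close>-class, so closed terms may be counted without the quotient.

  Upper bound: a canonical term of size \<open>n\<close> with \<open>p\<close> abstractions is determined by the word of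
  node arities in preorder (at most \<open>3 ^ n\<close> words) and the names below \<open>p\<close> of its
  \<open>(n + 1 - p) / 2\<close> leaves. The maximum over \<open>p\<close> of \<open>p powr ((n + 1 - p) / 2)\<close> is
  \<open>(n / (e ln n)) powr (n / 2)\<close> up to a factor \<open>exp (o n)\<close>, which \<open>\<epsilon>\<close> absorbs.

  Lower bound: put \<open>p\<close> abstractions, \<open>p\<close> about \<open>n / ln n\<close>, above an arbitrary
  abstraction-free term with \<open>q = (n + 1 - p) / 2\<close> leaves. There are \<open>p ^ q\<close> times a Catalan
  number of those, which exceeds the required bound by a factor
  \<open>exp ((1/2 + o 1) n ln (ln n) / ln n)\<close>.
\<close>

section \<open>Canonical representatives of \<alpha>-classes\<close>

primrec canonical :: "nat \<Rightarrow> lterm \<Rightarrow> bool" where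
  "canonical d (Var x) \<longleftrightarrow> x < d"
| "canonical d (App s t) \<longleftrightarrow> canonical d s \<and> canonical d t"
| "canonical d (Lam x t) \<longleftrightarrow> x = d \<and> canonical (Suc d) t"

lemma fv_canonical: "canonical d t \<Longrightarrow> fv t \<subseteq> {..<d}"
proof (induction t arbitrary: d)
  case (Lam x t)
  then have "fv t \<subseteq> {..<Suc d}" by simp
  then show ?case using Lam.prems by (auto simp: less_Suc_eq)
qed auto

primrec binders :: "lterm \<Rightarrow> nat set" where
  "binders (Var x) = {}"
| "binders (App s t) = binders s \<union> binders t"
| "binders (Lam x t) = insert x (binders t)"

lemma vars_eq: "vars t = fv t \<union> binders t"
  by (induction t) auto

lemma finite_vars: "finite (vars t)"
  by (induction t) auto

lemma binders_rename: "binders (rename x y t) = binders t"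
  by (induction t) auto

text \<open>Binders are replaced by fresh names from the inside out. This clears a chosen name from
  all binders, so that \<open>alpha.rename\<close> can later introduce it.\<close>

lemma alpha_avoid:
  assumes "finite A"
  shows "\<exists>t'. alpha t t' \<and> binders t' \<inter> A = {}"
proof (induction t)
  case (Var x)
  then show ?case by (intro exI[of _ "Var x"]) (auto intro: alpha.refl)
next
  case (App s t)
  then obtain s' t' where "alpha s s'" "binders s' \<inter> A = {}" "alpha t t'" "binders t' \<inter> A = {}"
    by blast
  then show ?case by (intro exI[of _ "App s' t'"]) (auto intro: alpha.app)
next
  case (Lam x t)
  then obtain t' where t': "alpha t t'" "binders t' \<inter> A = {}" by blast
  obtain y where y: "y \<notin> vars t' \<union> A"
    using ex_new_if_finite[of "vars t' \<union> A"] assms finite_vars by auto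
  have "alpha (Lam x t) (Lam y (rename x y t'))"
    using t'(1) y by (blast intro: alpha.trans alpha.lam alpha.rename)
  moreover have "binders (Lam y (rename x y t')) \<inter> A = {}"
    using t'(2) y by (simp add: binders_rename)
  ultimately show ?case by blast
qed

text \<open>Since \<open>alpha.rename\<close> requires \<open>d\<close> to be absent from the body,
  binders named \<open>d\<close> are cleared first. The recursion enters a renamed body rather than
  a subterm, hence induction on size.\<close>

lemma alpha_canonical: "fv t \<subseteq> {..<d} \<Longrightarrow> \<exists>t'. alpha t t' \<and> canonical d t'"
proof (induction t arbitrary: d rule: measure_induct_rule[of tsize])
  case (less t)
  show ?case
  proof (cases t)
    case (Var x)
    then show ?thesis using less.prems by (intro exI[of _ t]) (auto intro: alpha.refl)
  next
    case (App a b)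
    with less.prems less.IH[of a d] less.IH[of b d] obtain a' b' where
      "alpha a a'" "canonical d a'" "alpha b b'" "canonical d b'" by auto
    then show ?thesis unfolding App by (intro exI[of _ "App a' b'"]) (auto intro: alpha.app)
  next
    case (Lam x u)
    \<comment> \<open>The detour through \<open>y\<close> covers \<open>x = d\<close>, where
      \<open>d\<close> may be free in the body; \<open>y \<noteq> d\<close> keeps \<open>d\<close>
      out of \<open>fv u2\<close>.\<close>
    obtain y where y: "y \<notin> vars u \<union> {..d}"
      using ex_new_if_finite[of "vars u \<union> {..d}"] finite_vars by auto
    have fv1: "fv (rename x y u) \<subseteq> insert y {..<d}"
      using y less.prems unfolding Lam by (auto simp: fv_rename)
    obtain u2 where u2: "alpha (rename x y u) u2" "binders u2 \<inter> {d} = {}"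
      using alpha_avoid[of "{d}"] by blast
    have fv2: "fv u2 \<subseteq> insert y {..<d}" using alpha_fv[OF u2(1)] fv1 by simp
    then have d: "d \<notin> vars u2" using u2(2) y by (auto simp: vars_eq)
    have a: "alpha t (Lam d (rename y d u2))"
      unfolding Lam using y d u2(1) by (blast intro: alpha.trans alpha.lam alpha.rename)
    have "fv (rename y d u2) \<subseteq> {..<Suc d}"
      using fv2 d by (auto simp: fv_rename)
    moreover have "tsize (rename y d u2) < tsize t"
      using alpha_tsize[OF u2(1)] Lam by simp
    ultimately obtain u3 where "alpha (rename y d u2) u3" "canonical (Suc d) u3"
      using less.IH by blast
    then show ?thesis using a
      by (intro exI[of _ "Lam d u3"]) (auto intro: alpha.trans alpha.lam)
  qed
qed

text \<open>An \<alpha>-invariant that fixes canonical terms and hence separates them. The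
  environment \<open>\<sigma>\<close> sends a bound name to the depth of its innermost
  binder.\<close>

primrec normal_form :: "nat \<Rightarrow> (nat \<Rightarrow> nat) \<Rightarrow> lterm \<Rightarrow> lterm" where
  "normal_form d \<sigma> (Var x) = Var (\<sigma> x)"
| "normal_form d \<sigma> (App s t) = App (normal_form d \<sigma> s) (normal_form d \<sigma> t)"
| "normal_form d \<sigma> (Lam x t) = Lam d (normal_form (Suc d) (\<sigma>(x := d)) t)"

lemma normal_form_cong:
  "(\<And>x. x \<in> vars t \<Longrightarrow> \<sigma> x = \<tau> x) \<Longrightarrow> normal_form d \<sigma> t = normal_form d \<tau> t"
proof (induction t arbitrary: d \<sigma> \<tau>)
  case (App s t)
  from App.IH[of \<sigma> \<tau> d] App.prems show ?case by simp
next
  case (Lam y t)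
  have "normal_form (Suc d) (\<sigma>(y := d)) t = normal_form (Suc d) (\<tau>(y := d)) t"
    using Lam.prems by (intro Lam.IH) auto
  then show ?case by simp
qed simp

lemma normal_form_rename:
  "y \<notin> vars t \<Longrightarrow> normal_form d (\<sigma>(y := a)) (rename x y t) = normal_form d (\<sigma>(x := a)) t"
proof (induction t arbitrary: d \<sigma>)
  case (Lam z t)
  show ?case
  proof (cases "z = x")
    case True
    \<comment> \<open>The inner binder overwrites the entry for \<open>x\<close>, and
      \<open>y\<close> does not occur, so both environments agree on \<open>vars t\<close>.\<close>
    then show ?thesis using Lam.prems by (auto intro!: normal_form_cong)
  next
    case False
    have "normal_form (Suc d) (\<sigma>(z := d, y := a)) (rename x y t)
        = normal_form (Suc d) (\<sigma>(z := d, x := a)) t"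
      using Lam.prems by (intro Lam.IH) simp
    moreover have "\<sigma>(y := a, z := d) = \<sigma>(z := d, y := a)" "\<sigma>(x := a, z := d) = \<sigma>(z := d, x := a)"
      using False Lam.prems by (auto intro!: fun_upd_twist)
    ultimately show ?thesis
      by (simp only: rename.simps normal_form.simps False if_False)
  qed
qed auto

lemma normal_form_alpha: "alpha s t \<Longrightarrow> normal_form d \<sigma> s = normal_form d \<sigma> t"
  by (induction arbitrary: d \<sigma> rule: alpha.induct) (auto simp: normal_form_rename)

lemma normal_form_canonical: "canonical d t \<Longrightarrow> (\<And>x. x < d \<Longrightarrow> \<sigma> x = x) \<Longrightarrow> normal_form d \<sigma> t = t"
  by (induction t arbitrary: d \<sigma>) auto

text \<open>Taking classes is onto by \<open>alpha_canonical\<close> and injective on canonical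
  terms by invariance of \<open>normal_form\<close>.\<close>

lemma num_closed_eq: "num_closed n = card {t. canonical 0 t \<and> tsize t = n}"
proof -
  let ?C = "{t. canonical 0 t \<and> tsize t = n}" and ?T = "{t. fv t = {} \<and> tsize t = n}"
  let ?cl = "\<lambda>t. alpha_rel `` {t}"
  have "?cl ` ?C = ?T // alpha_rel"
  proof (intro subset_antisym subsetI)
    fix X assume "X \<in> ?cl ` ?C"
    then show "X \<in> ?T // alpha_rel" using fv_canonical by (fastforce intro: quotientI)
  next
    fix X assume "X \<in> ?T // alpha_rel"
    then obtain t where t: "fv t = {}" "tsize t = n" "X = ?cl t" by (auto elim: quotientE)
    then obtain t' where t': "alpha t t'" "canonical 0 t'" using alpha_canonical[of t 0] by auto
    then have "?cl t = ?cl t'"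
      by (intro equiv_class_eq[OF equiv_alpha_rel]) (simp add: alpha_rel_def)
    then show "X \<in> ?cl ` ?C" using t t' alpha_tsize by auto
  qed
  moreover have inj: "inj_on ?cl ?C"
  proof (rule inj_onI)
    fix s t assume st: "s \<in> ?C" "t \<in> ?C" and eq: "?cl s = ?cl t"
    have "alpha s t"
      using eq_equiv_class[OF eq equiv_alpha_rel UNIV_I] by (simp add: alpha_rel_def)
    then show "s = t"
      using st normal_form_alpha[of s t 0 id] by (simp add: normal_form_canonical)
  qed
  ultimately show ?thesis unfolding num_closed_def by (simp flip: card_image[OF inj])
qed

section \<open>Encoding by arity words and leaf names\<close>

primrec shape :: "lterm \<Rightarrow> nat list" where
  "shape (Var x) = [0]"
| "shape (App s t) = 2 # shape s @ shape t"
| "shape (Lam x t) = 1 # shape t"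

primrec leaves :: "lterm \<Rightarrow> nat list" where
  "leaves (Var x) = [x]"
| "leaves (App s t) = leaves s @ leaves t"
| "leaves (Lam x t) = leaves t"

lemma length_shape: "length (shape t) = tsize t"
  by (induction t) auto

lemma set_shape: "set (shape t) \<subseteq> {..<3}"
  by (induction t) auto

text \<open>Leaves outnumber applications by one, so size and number of abstractions determine the
  number of leaves.\<close>

lemma length_leaves: "2 * length (leaves t) + count_list (shape t) 1 = Suc (tsize t)"
  by (induction t) auto

text \<open>A leaf name is below the depth of the leaf, which exceeds \<open>d\<close> by at most
  the number of abstractions.\<close>

lemma set_leaves: "canonical d t \<Longrightarrow> set (leaves t) \<subseteq> {..<d + count_list (shape t) 1}"
proof (induction t arbitrary: d)
  case (App s t)
  have "{..<d + count_list (shape s) 1} \<union> {..<d + count_list (shape t) 1}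
      \<subseteq> {..<d + count_list (shape (App s t)) 1}" by auto
  then show ?case using App.IH[of d] App.prems by auto
next
  case (Lam x t)
  then show ?case using Lam.IH[of "Suc d"] by simp
qed auto

text \<open>Preorder arity words form a prefix code; arbitrary suffixes carry the induction through
  \<open>App\<close>. Binder names are not encoded, since canonicity recovers them from the
  depth.\<close>

lemma canonical_decode:
  assumes "canonical d s" "canonical d t" "shape s @ v = shape t @ w" "leaves s @ a = leaves t @ b"
  shows "s = t \<and> v = w \<and> a = b"
  using assms
proof (induction s arbitrary: d t v w a b)
  case (Var x)
  then show ?case by (cases t) auto
next
  case (App s1 s2)
  from App.prems obtain t1 t2 where t: "t = App t1 t2" by (cases t) auto
  have "s1 = t1 \<and> shape s2 @ v = shape t2 @ w \<and> leaves s2 @ a = leaves t2 @ b"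
    using App.prems unfolding t by (intro App.IH(1)[of d]) auto
  moreover from this have "s2 = t2 \<and> v = w \<and> a = b"
    using App.prems unfolding t by (intro App.IH(2)[of d]) auto
  ultimately show ?case unfolding t by simp
next
  case (Lam x s)
  from Lam.prems obtain y t1 where t: "t = Lam y t1" by (cases t) auto
  have "s = t1 \<and> v = w \<and> a = b"
    using Lam.prems unfolding t by (intro Lam.IH[of "Suc d"]) auto
  then show ?case using Lam.prems unfolding t by simp
qed

definition encodings :: "nat \<Rightarrow> (nat list \<times> nat list) set" where
  "encodings n = (SIGMA w:{w. set w \<subseteq> {..<3} \<and> length w = n}.
     {l. set l \<subseteq> {..<count_list w 1} \<and> length l = (Suc n - count_list w 1) div 2})"

lemma encoding_inj: "inj_on (\<lambda>t. (shape t, leaves t)) {t. canonical 0 t \<and> tsize t = n}"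
proof (rule inj_onI)
  fix s t
  assume "s \<in> {t. canonical 0 t \<and> tsize t = n}" "t \<in> {t. canonical 0 t \<and> tsize t = n}"
    "(shape s, leaves s) = (shape t, leaves t)"
  then show "s = t" using canonical_decode[of 0 s t "[]" "[]" "[]" "[]"] by simp
qed

lemma encoding_image: "(\<lambda>t. (shape t, leaves t)) ` {t. canonical 0 t \<and> tsize t = n} \<subseteq> encodings n"
proof clarify
  fix t assume t: "canonical 0 t" "n = tsize t"
  have "length (leaves t) = (Suc n - count_list (shape t) 1) div 2"
    using length_leaves[of t] t(2) by linarith
  then show "(shape t, leaves t) \<in> encodings (tsize t)"
    using set_shape[of t] set_leaves[OF t(1)] t(2) by (simp add: encodings_def length_shape)
qed

lemma finite_encodings: "finite (encodings n)"
  unfolding encodings_def by (intro finite_SigmaI finite_lists_length_eq) auto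

lemma finite_canonical: "finite {t. canonical 0 t \<and> tsize t = n}"
  using finite_imageD[OF finite_subset[OF encoding_image finite_encodings] encoding_inj] .

text \<open>Each of the \<open>3 ^ n\<close> words fixes the number \<open>p\<close> of abstractions
  and leaves at most \<open>B\<close> choices of leaf names.\<close>

lemma num_closed_le_shapes:
  fixes B :: real
  assumes "\<And>p. p \<le> n \<Longrightarrow> real p ^ ((Suc n - p) div 2) \<le> B"
  shows "real (num_closed n) \<le> 3 ^ n * B"
proof -
  let ?W = "{w. set w \<subseteq> {..<3::nat} \<and> length w = n}"
  have finW: "finite ?W" by (intro finite_lists_length_eq) simp
  have "num_closed n \<le> card (encodings n)"
    unfolding num_closed_eq
    using card_mono[OF finite_encodings encoding_image] card_image[OF encoding_inj] by metis
  also have "card (encodings n) = (\<Sum>w\<in>?W. count_list w 1 ^ ((Suc n - count_list w 1) div 2))"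
    unfolding encodings_def using finW
    by (subst card_SigmaI) (auto intro!: finite_lists_length_eq simp: card_lists_length_eq)
  finally have "real (num_closed n)
      \<le> (\<Sum>w\<in>?W. real (count_list w 1) ^ ((Suc n - count_list w 1) div 2))"
    by (simp flip: of_nat_power of_nat_sum)
  also have "\<dots> \<le> (\<Sum>w\<in>?W. B)"
    by (intro sum_mono assms) (auto simp: count_le_length)
  also have "\<dots> = 3 ^ n * B"
    by (simp add: card_lists_length_eq)
  finally show ?thesis .
qed

section \<open>Abstraction-free terms and Catalan numbers\<close>

primrec lam_free :: "nat \<Rightarrow> lterm \<Rightarrow> bool" where
  "lam_free p (Var x) \<longleftrightarrow> x < p"
| "lam_free p (App s t) \<longleftrightarrow> lam_free p s \<and> lam_free p t"
| "lam_free p (Lam x t) \<longleftrightarrow> False"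

definition trees :: "nat \<Rightarrow> nat \<Rightarrow> lterm set" where
  "trees p q = {t. lam_free p t \<and> length (leaves t) = q}"

lemma leaves_nonempty [simp]: "leaves t \<noteq> []"
  by (induction t) auto

lemma lam_free_tsize: "lam_free p t \<Longrightarrow> Suc (tsize t) = 2 * length (leaves t)"
  by (induction t) auto

lemma lam_free_canonical: "lam_free p t \<Longrightarrow> canonical p t"
  by (induction t) auto

lemma trees_0: "trees p 0 = {}"
  by (auto simp: trees_def)

lemma trees_1: "trees p (Suc 0) = Var ` {..<p}"
proof -
  have "t \<in> Var ` {..<p}" if "lam_free p t" "length (leaves t) = Suc 0" for t
    using that by (cases t) (auto simp: add_is_1)
  then show ?thesis by (auto simp: trees_def)
qed

text \<open>Split at the root by the number of leaves on the left. The empty ends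
  \<open>i = 0\<close> and \<open>i = q\<close> are kept to match a full Cauchy product.\<close>

lemma trees_rec:
  assumes "q \<noteq> Suc 0"
  shows "trees p q = (\<Union>i\<in>{0..q}. case_prod App ` (trees p i \<times> trees p (q - i)))" (is "_ = ?R")
proof (intro subset_antisym subsetI)
  fix t assume t: "t \<in> trees p q"
  then obtain s u where "t = App s u" using assms by (cases t) (auto simp: trees_def)
  with t show "t \<in> ?R"
    by (intro UN_I[of "length (leaves s)"]) (auto simp: trees_def)
qed (auto simp: trees_def)


lemma finite_trees: "finite (trees p q)"
proof (induction q rule: less_induct)
  case (less q)
  show ?case
  proof (cases "q = Suc 0")
    case False
    \<comment> \<open>At either end one factor is empty; otherwise both indices are smaller than
      \<open>q\<close>.\<close>
    have "finite (trees p i \<times> trees p (q - i))" if "i \<le> q" for i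
      using that less[of i] less[of "q - i"] by (cases "i = 0 \<or> i = q") (auto simp: trees_0)
    then show ?thesis by (subst trees_rec[OF False]) auto
  qed (simp add: trees_1)
qed

lemma card_trees_rec:
  assumes "q \<noteq> Suc 0"
  shows "card (trees p q) = (\<Sum>i=0..q. card (trees p i) * card (trees p (q - i)))"
proof -
  have inj: "inj (case_prod App)" by (auto intro: injI)
  have "card (trees p q) = (\<Sum>i=0..q. card (case_prod App ` (trees p i \<times> trees p (q - i))))"
    by (subst trees_rec[OF assms], subst card_UN_disjoint) (auto simp: finite_trees, auto simp: trees_def)
  then show ?thesis by (simp add: card_image[OF inj_on_subset[OF inj subset_UNIV]] card_cartesian_product)
qed

text \<open>The generating function \<open>B\<close> satisfies \<open>B = p X + B\<^sup>2\<close>, so \<open>S = 1 - 2 B\<close> is a square root of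
  \<open>1 - 4 p X\<close> and solves \<open>(1 - 4 p X) S' = - 2 p S\<close>.\<close>

lemma card_trees_Suc:
  assumes "q > 0"
  shows "(real q + 1) * card (trees p (Suc q)) = (4 * real q - 2) * p * card (trees p q)"
proof -
  define B where "B = Abs_fps (\<lambda>q. real (card (trees p q)))"
  define S where "S = 1 - 2 * B"
  have "B = fps_const (real p) * fps_X + B * B"
    unfolding fps_eq_iff
  proof
    fix n show "fps_nth B n = fps_nth (fps_const (real p) * fps_X + B * B) n"
    proof (cases "n = Suc 0")
      case True
      then show ?thesis by (simp add: B_def fps_mult_nth[of "Abs_fps _" "Abs_fps _"] trees_0 trees_1 card_image inj_on_def)
    next
      case False
      then show ?thesis by (simp add: B_def fps_mult_nth[of "Abs_fps _" "Abs_fps _"] card_trees_rec[OF False])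
    qed
  qed
  then have S2: "S * S = 1 - 4 * fps_const (real p) * fps_X"
    unfolding S_def by algebra
  then have "fps_deriv (S * S) = - (4 * fps_const (real p))" by simp
  then have "2 * (S * fps_deriv S) = 2 * - (2 * fps_const (real p))" by (simp add: algebra_simps)
  then have "S * fps_deriv S = - (2 * fps_const (real p))" unfolding mult_cancel_left by simp
  \<comment> \<open>Multiplying by \<open>S\<close> makes \<open>S * S\<close> appear, whose value
    is known; the equation becomes linear in \<open>S\<close>.\<close>
  then have "(1 - 4 * fps_const (real p) * fps_X) * fps_deriv S = - (2 * fps_const (real p)) * S"
    unfolding S2[symmetric] by algebra
  then have "fps_deriv S - fps_const (4 * real p) * (fps_X * fps_deriv S) = fps_const (- 2 * real p) * S"
    by (simp add: algebra_simps numeral_fps_const flip: fps_const_mult fps_const_neg)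
  then have "fps_nth (fps_deriv S - fps_const (4 * real p) * (fps_X * fps_deriv S)) q
      = fps_nth (fps_const (- 2 * real p) * S) q"
    by simp
  \<comment> \<open>The constant coefficient of \<open>S\<close> is 1, hence the restriction to
    \<open>n > 0\<close>.\<close>
  moreover have "fps_nth S n = - 2 * real (card (trees p n))" if "n > 0" for n
    using that by (simp add: S_def B_def numeral_fps_const)
  ultimately show ?thesis using assms by (simp add: algebra_simps)
qed

text \<open>The cardinality is \<open>p ^ q\<close> times a Catalan number of order
  \<open>4 ^ q / q powr (3/2)\<close>. The cruder factor \<open>q ^ 2\<close> reduces the induction
  step to a polynomial inequality.\<close>

lemma card_trees_ge:
  assumes "q > 0"
  shows "(4 * real p) ^ q \<le> 4 * real q ^ 2 * card (trees p q)"
  using assms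
proof (induction q rule: nat_induct_non_zero)
  case 1
  show ?case by (simp add: trees_1 card_image inj_on_def)
next
  case (Suc q)
  let ?c = "\<lambda>q. real (card (trees p q))"
  have "2 * real q ^ 2 \<le> (2 * real q - 1) * (real q + 1)"
    using Suc.hyps by (simp add: power2_eq_square algebra_simps)
  then have *: "2 * real q ^ 2 * (8 * p * ?c q) \<le> (2 * real q - 1) * (real q + 1) * (8 * p * ?c q)"
    by (intro mult_right_mono) auto
  have "(4 * real p) ^ Suc q \<le> 4 * real p * (4 * real q ^ 2 * ?c q)"
    unfolding power_Suc by (intro mult_left_mono Suc.IH) simp
  also have "\<dots> \<le> 4 * (real q + 1) * ((4 * real q - 2) * p * ?c q)"
    using * by (simp add: power2_eq_square algebra_simps)
  also have "\<dots> = 4 * real (Suc q) ^ 2 * ?c (Suc q)"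
    unfolding card_trees_Suc[OF Suc.hyps, symmetric] by (simp add: power2_eq_square algebra_simps)
  finally show ?case .
qed

section \<open>Lower bound from a prefix of abstractions\<close>

lemma canonical_foldr_Lam:
  "d \<le> p \<Longrightarrow> canonical p t \<Longrightarrow> canonical d (foldr Lam [d..<p] t)"
  by (induction d rule: inc_induct) (auto simp: upt_conv_Cons)

lemma foldr_Lam_inject: "foldr Lam xs s = foldr Lam xs t \<longleftrightarrow> s = t"
  by (induction xs) auto

lemma tsize_foldr_Lam: "tsize (foldr Lam xs t) = length xs + tsize t"
  by (induction xs) auto

text \<open>A binary tree with \<open>q\<close> leaves has size \<open>2 * q - 1\<close>; the
  \<open>p\<close> abstractions above it bring the size to \<open>n\<close>.\<close>

lemma num_closed_ge_trees:
  assumes "q > 0" "n + 1 = p + 2 * q"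
  shows "card (trees p q) \<le> num_closed n"
proof -
  have "inj_on (foldr Lam [0..<p]) (trees p q)"
    by (auto intro!: inj_onI simp: foldr_Lam_inject)
  moreover have "foldr Lam [0..<p] ` trees p q \<subseteq> {t. canonical 0 t \<and> tsize t = n}"
    using assms lam_free_tsize
    by (fastforce simp: trees_def tsize_foldr_Lam canonical_foldr_Lam lam_free_canonical)
  ultimately show ?thesis
    unfolding num_closed_eq using finite_canonical by (rule card_inj_on_le)
qed

text \<open>\<open>L\<close> is rounded up to an integer \<open>p\<close> with the parity of
  \<open>n + 1\<close>: \<open>p \<ge> L\<close> serves the base and \<open>p < L + 2\<close> the
  exponent.\<close>

lemma num_closed_lower:
  fixes n :: nat and L :: real
  assumes "1 \<le> L" "L + 2 \<le> n"
  shows "(4 * L) powr ((real n - 1 - L) / 2) / (4 * real n ^ 2) \<le> num_closed n"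
proof -
  define p0 where "p0 = nat \<lceil>L\<rceil>"
  define p where "p = (if even (n + 1 - p0) then p0 else p0 + 1)"
  define q where "q = (n + 1 - p) div 2"
  have p0: "L \<le> p0" "real p0 < L + 1" using assms(1) unfolding p0_def by linarith+
  then have p: "L \<le> p" "real p < L + 2" by (auto simp: p_def)
  then have "p < n" using assms by linarith
  moreover have "even (n + 1 - p)"
    unfolding p_def using \<open>p < n\<close> by (auto simp: p_def split: if_splits)
  ultimately have q: "n + 1 = p + 2 * q" "q > 0" by (auto simp: q_def)
  \<comment> \<open>Here \<open>q = (n + 1 - p) / 2 > (n - 1 - L) / 2\<close>, and the base is at
    least 1.\<close>
  have "(4 * L) powr ((real n - 1 - L) / 2) \<le> (4 * L) powr q"
    using assms p arg_cong[OF q(1), of real] by (intro powr_mono) auto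
  also have "\<dots> = (4 * L) ^ q" using assms by (simp add: powr_realpow)
  also have "\<dots> \<le> (4 * real p) ^ q" using assms p by (intro power_mono) auto
  also have "\<dots> \<le> 4 * real q ^ 2 * card (trees p q)" by (rule card_trees_ge[OF q(2)])
  also have "\<dots> \<le> 4 * real n ^ 2 * num_closed n"
    using num_closed_ge_trees[OF q(2,1)] q assms by (intro mult_mono power_mono) auto
  finally show ?thesis using assms by (simp add: field_simps)
qed

section \<open>Upper bound by maximising over the number of abstractions\<close>

lemma powr_le_max:
  fixes a K p :: real
  assumes "p > 0" "a > 0" "K > 0" "K \<le> ln p"
  shows "p powr (a - p) \<le> (a / (exp 1 * K)) powr a"
proof -
  \<comment> \<open>The tangent bound \<open>ln x \<le> x - 1\<close>, tight at
    \<open>p = a / K\<close>, which maximises \<open>a * ln p - K * p\<close>.\<close>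
  have "a * ln (p * K / a) \<le> a * (p * K / a - 1)"
    using assms by (intro mult_left_mono ln_le_minus_one) auto
  moreover have "K * p \<le> p * ln p" using assms by (simp add: mult.commute)
  moreover have "a * ln (p * K / a) = a * ln p + a * ln K - a * ln a"
    "a * (p * K / a - 1) = K * p - a" "a * ln (a / (exp 1 * K)) = a * ln a - a - a * ln K"
    using assms by (simp_all add: ln_mult ln_div field_simps)
  ultimately have "(a - p) * ln p \<le> a * ln (a / (exp 1 * K))"
    by (simp only: left_diff_distrib)
  then show ?thesis using assms by (simp add: powr_def)
qed

text \<open>\<open>K\<close> is the logarithm of \<open>n / (ln n)\<^sup>2\<close>. Smaller \<open>p\<close> already satisfy the bound trivially,
  and for larger ones replacing \<open>p ln p\<close> by \<open>p K\<close> makes the maximum over \<open>p\<close> explicit.\<close>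

lemma num_closed_upper:
  fixes n :: nat
  defines "K \<equiv> ln (real n) - 2 * ln (ln (real n))"
  assumes "n > 0" "ln (real n) > 0" "K > 0" "exp 1 * K \<le> ln (real n) ^ 2"
  shows "num_closed n \<le> 3 ^ n * ((real n + 1) / (exp 1 * K)) powr ((real n + 1) / 2)"
proof (rule num_closed_le_shapes)
  fix p :: nat assume p: "p \<le> n"
  let ?M = "(real n + 1) / (exp 1 * K)"
  show "real p ^ ((Suc n - p) div 2) \<le> ?M powr ((real n + 1) / 2)"
  proof (cases "p = 0")
    case False
    have "2 * ((Suc n - p) div 2) + p \<le> n + 1"
      using p by presburger
    then have "real ((Suc n - p) div 2) \<le> (real n + 1 - p) / 2"
      using of_nat_mono[where 'a = real] by fastforce
    then have "real p ^ ((Suc n - p) div 2) \<le> real p powr ((real n + 1 - p) / 2)"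
      using False by (subst powr_realpow[symmetric]) (auto intro!: powr_mono)
    \<comment> \<open>Pulling out the square root gives the exponent the form \<open>a - p\<close>
      with \<open>a = n + 1\<close>.\<close>
    also have "\<dots> = sqrt (real p powr (real n + 1 - p))"
      by (simp add: powr_half_sqrt_powr)
    also have "real p powr (real n + 1 - p) \<le> ?M powr (real n + 1)"
    proof (cases "K \<le> ln (real p)")
      case True
      then show ?thesis using False assms by (intro powr_le_max) auto
    next
      case lnp: False
      have "ln (real n / ln (real n) ^ 2) = K"
        using assms by (simp add: K_def ln_div ln_realpow)
      then have "ln (real p) < ln (real n / ln (real n) ^ 2)" using lnp by simp
      then have "real p < real n / ln (real n) ^ 2"
        by (subst (asm) ln_less_cancel_iff) (use assms False in auto)
      also have "\<dots> \<le> ?M"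
        using assms by (intro frac_le) auto
      finally have "real p powr (real n + 1) \<le> ?M powr (real n + 1)"
        by (intro powr_mono2) auto
      moreover have "real p powr (real n + 1 - p) \<le> real p powr (real n + 1)"
        using False by (intro powr_mono) auto
      ultimately show ?thesis by linarith
    qed
    also have "sqrt (?M powr (real n + 1)) = ?M powr ((real n + 1) / 2)"
      using assms by (simp add: powr_half_sqrt_powr)
    finally show ?thesis by simp
  next
    case True
    \<comment> \<open>A positive exponent, from \<open>n > 0\<close>, makes the power 0 and rules
      out \<open>0 ^ 0 = 1\<close>.\<close>
    have "(Suc n - p) div 2 > 0" using True assms by (simp add: div_greater_zero_iff)
    then show ?thesis using True by (simp add: power_0_left)
  qed
qed

section \<open>Asymptotic comparison with the stated bounds\<close>

lemma lower_asymp: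
  "\<forall>\<^sub>F n :: nat in sequentially.
     (4 * real n / (exp 1 * ln (real n))) powr (real n / 2) * (sqrt (ln (real n)) / real n)
     \<le> (4 * (real n / ln (real n))) powr ((real n - 1 - real n / ln (real n)) / 2) / (4 * real n ^ 2)"
proof -
  \<comment> \<open>In logarithms, shortening the exponent by \<open>n / (2 * ln n)\<close> costs
    \<open>n / 2\<close> to leading order, which the factor \<open>exp 1\<close> on the left
    offsets. The remaining gain of order \<open>n * ln (ln n) / ln n\<close> dominates the
    logarithmic terms.\<close>
  have "\<forall>\<^sub>F n :: nat in sequentially.
      real n / 2 * (ln 4 + ln (real n) - 1 - ln (ln (real n))) + ln (ln (real n)) / 2 - ln (real n)
      \<le> (real n - 1 - real n / ln (real n)) / 2 * (ln 4 + ln (real n) - ln (ln (real n)))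
          - ln 4 - 2 * ln (real n)"
    by real_asymp
  moreover have "\<forall>\<^sub>F n :: nat in sequentially. ln (real n) > 0" by real_asymp
  ultimately show ?thesis using eventually_gt_at_top[of 0]
  proof eventually_elim
    case (elim n)
    then have "ln ((4 * real n / (exp 1 * ln (real n))) powr (real n / 2) * (sqrt (ln (real n)) / real n))
      \<le> ln ((4 * (real n / ln (real n))) powr ((real n - 1 - real n / ln (real n)) / 2) / (4 * real n ^ 2))"
      by (simp add: ln_mult ln_div ln_powr ln_sqrt ln_realpow algebra_simps)
    then show ?case
      by (subst (asm) ln_le_cancel_iff) (use elim in auto)
  qed
qed

text \<open>In logarithms, having \<open>K\<close> in place of \<open>ln n\<close> costs about
  \<open>n * ln (ln n) / ln n\<close>. This is \<open>o(n)\<close>, so the linear term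
  \<open>n / 2 * ln (1 + \<epsilon>)\<close> absorbs it.\<close>

lemma upper_asymp:
  assumes "\<epsilon> > 0"
  shows "\<forall>\<^sub>F n :: nat in sequentially.
     3 ^ n * ((real n + 1) / (exp 1 * (ln (real n) - 2 * ln (ln (real n))))) powr ((real n + 1) / 2)
     \<le> (9 * (1 + \<epsilon>) * real n / (exp 1 * ln (real n))) powr (real n / 2)
              * (ln (real n) powr (real n / (2 * ln (real n))) / real n powr (3 / 2))"
proof -
  have "ln (1 + \<epsilon>) > 0" using assms by simp
  then have "\<forall>\<^sub>F n :: nat in sequentially.
      (real n + 1) / 2 * (ln (real n + 1) - 1 - ln (ln (real n) - 2 * ln (ln (real n))))
      \<le> real n / 2 * (ln (1 + \<epsilon>) + ln (real n) - 1 - ln (ln (real n)))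
          + real n / (2 * ln (real n)) * ln (ln (real n)) - 3 / 2 * ln (real n)"
    by real_asymp
  moreover have "\<forall>\<^sub>F n :: nat in sequentially. ln (real n) > 0"
    "\<forall>\<^sub>F n :: nat in sequentially. ln (real n) - 2 * ln (ln (real n)) > 0"
    by real_asymp+
  ultimately show ?thesis using eventually_gt_at_top[of 0]
  proof eventually_elim
    case (elim n)
    let ?K = "ln (real n) - 2 * ln (ln (real n))"
    let ?X = "ln (1 + \<epsilon>) + ln (real n) - 1 - ln (ln (real n))"
    \<comment> \<open>The 9 in the bound is there to cancel
      \<open>3 ^ n = 9 powr (n / 2)\<close>.\<close>
    have "ln (9 :: real) = 2 * ln 3" using ln_realpow[of "3::real" 2] by simp
    then have M: "ln ((real n + 1) / (exp 1 * ?K)) = ln (real n + 1) - 1 - ln ?K"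
      "ln (9 * (1 + \<epsilon>) * real n / (exp 1 * ln (real n)))
         = 2 * ln 3 + ?X"
      using elim assms by (simp_all add: ln_mult ln_div del: distrib_left_numeral)
    have "ln (3 ^ n * ((real n + 1) / (exp 1 * ?K)) powr ((real n + 1) / 2))
      = real n * ln 3 + (real n + 1) / 2 * (ln (real n + 1) - 1 - ln ?K)"
      unfolding M(1)[symmetric] using elim by (simp add: ln_mult ln_powr ln_realpow)
    moreover have "ln ((9 * (1 + \<epsilon>) * real n / (exp 1 * ln (real n))) powr (real n / 2)
              * (ln (real n) powr (real n / (2 * ln (real n))) / real n powr (3 / 2)))
      = real n / 2 * (2 * ln 3 + ?X)
          + real n / (2 * ln (real n)) * ln (ln (real n)) - 3 / 2 * ln (real n)"
      unfolding M(2)[symmetric] using elim assms by (simp add: ln_mult ln_div ln_powr)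
    moreover have "real n / 2 * (2 * ln 3 + ?X) = real n * ln 3 + real n / 2 * ?X"
      by (simp add: algebra_simps)
    ultimately have "ln (3 ^ n * ((real n + 1) / (exp 1 * ?K)) powr ((real n + 1) / 2))
      \<le> ln ((9 * (1 + \<epsilon>) * real n / (exp 1 * ln (real n))) powr (real n / 2)
              * (ln (real n) powr (real n / (2 * ln (real n))) / real n powr (3 / 2)))"
      using elim(1) by linarith
    then show ?case
      by (subst (asm) ln_le_cancel_iff) (use elim assms in auto)
  qed
qed

theorem theorem3:
  "\<exists>c1 c2 :: real. c1 > 0 \<and> c2 > 0 \<and>
    (\<forall>\<epsilon> :: real. \<epsilon> > 0 \<longrightarrow>
      (\<forall>\<^sub>F n :: nat in sequentially.
        c1 * (4 * real n / (exp 1 * ln (real n))) powr (real n / 2)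
            * (sqrt (ln (real n)) / real n)
          \<le> real (num_closed n) \<and>
        real (num_closed n)
          \<le> c2 * (9 * (1 + \<epsilon>) * real n / (exp 1 * ln (real n))) powr (real n / 2)
              * (ln (real n) powr (real n / (2 * ln (real n))) / real n powr (3 / 2))))"
proof (intro exI conjI allI impI)
  fix \<epsilon> :: real assume "\<epsilon> > 0"
  \<comment> \<open>Both comparisons have slack, so \<open>c1 = c2 = 1\<close> works. These are the
    side conditions of \<open>num_closed_lower\<close> at \<open>L = n / ln n\<close> and of
    \<open>num_closed_upper\<close>.\<close>
  have "\<forall>\<^sub>F n :: nat in sequentially. 1 \<le> real n / ln (real n)"
    "\<forall>\<^sub>F n :: nat in sequentially. real n / ln (real n) + 2 \<le> real n"
    "\<forall>\<^sub>F n :: nat in sequentially. ln (real n) > 0"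
    "\<forall>\<^sub>F n :: nat in sequentially. ln (real n) - 2 * ln (ln (real n)) > 0"
    "\<forall>\<^sub>F n :: nat in sequentially. exp 1 * (ln (real n) - 2 * ln (ln (real n))) \<le> ln (real n) ^ 2"
    by real_asymp+
  with lower_asymp upper_asymp[OF \<open>\<epsilon> > 0\<close>] eventually_gt_at_top[of 0]
  show "\<forall>\<^sub>F n :: nat in sequentially.
        1 * (4 * real n / (exp 1 * ln (real n))) powr (real n / 2)
            * (sqrt (ln (real n)) / real n)
          \<le> real (num_closed n) \<and>
        real (num_closed n)
          \<le> 1 * (9 * (1 + \<epsilon>) * real n / (exp 1 * ln (real n))) powr (real n / 2)
              * (ln (real n) powr (real n / (2 * ln (real n))) / real n powr (3 / 2))"
  proof eventually_elim
    case (elim n)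
    then show ?case
      using num_closed_lower[of "real n / ln (real n)" n] num_closed_upper[of n] by simp
  qed
qed simp_all

end
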